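(* Let $n\in\mathbb{N}$, let $m=10^n$, and let $0=a_0<a_1<\cdots<a_{m-1}<a_m=1$ be a partition of the interval $[0,1)$. For each $j\in\{0,\ldots,m-1\}$ let $h_j:[0,1]\to[0,\infty)$ be a probability density function, and for $x\in[0,1)$ with $a_j\le x<a_{j+1}$ define $$g^{\dagger}(x)=h_j\!\left(\frac{x-a_j}{a_{j+1}-a_j}\right).$$ Then for all $j$, $$\int_{a_j}^{a_{j+1}}g^{\dagger}(x)\,dx=a_{j+1}-a_j .$$ Therefore $g^{\dagger}$ behaves as the uniform density (the function equal to $1$ on $[0,1)$) when integrated over intervals of the form $[a_k,a_\ell)$ with $0\le k<\ell\le m$, that is, $\int_{a_k}^{a_\ell}g^{\dagger}(x)\,dx=a_\ell-a_k$. By a construction of this form one can produce, for arbitrarily large $n$, a function $g^{\dagger}$ satisfying, for all $d_1\in\{1,\ldots,9\}$ and all $d_i\in\{0,1,\ldots,9\}$, $2\le i\le n$, $$\int_{\log\left(d_1+\frac{d_2}{10}+\cdots+\frac{d_n}{10^{n-1}}\right)}^{\log\left(d_1+\frac{d_2}{10}+\cdots+\frac{d_n+1}{10^{n-1}}\right)}g^{\dagger}(x)\,dx=\log\left(1+\frac{1}{10^{n-1}d_1+10^{n-2}d_2+\cdots+d_n}\right).$$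
   Context: Throughout, $\log$ denotes the base $10$ logarithm. The function $g^{\dagger}$ on $[0,1)$ plays the role of a mod 1 density: for a function $g:\mathbb{R}\to\mathbb{R}$, one writes $g^{\dagger}(x)=\sum_{k=-\infty}^{\infty}g(x+k)$ for $x\in[0,1)$ and $g^{\dagger}(x)=0$ otherwise. For $n=1$ the integration limits in the last display are $\log d_1$ and $\log(d_1+1)$. *)

theory Defs
  imports "HOL-Analysis.Analysis"
begin

definition unit_partition :: "nat \<Rightarrow> (nat \<Rightarrow> real) \<Rightarrow> bool" where
  "unit_partition m a \<longleftrightarrow> a 0 = 0 \<and> a m = 1 \<and> (\<forall>j<m. a j < a (Suc j))"

text \<open>Only the values of \<open>h\<close> on the closed unit interval matter. Measurability is Lebesgue
  measurability, so Borel densities are covered as well.\<close>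

definition unit_density :: "(real \<Rightarrow> real) \<Rightarrow> bool" where
  "unit_density h \<longleftrightarrow>
     (\<forall>x\<in>{0..1}. 0 \<le> h x) \<and>
     set_integrable lebesgue {0..1} h \<and>
     (LINT x:{0..1}|lebesgue. h x) = 1"

text \<open>For a partition \<open>a\<close> of \<open>[0,1)\<close> into \<open>m\<close> cells, every \<open>x\<close> in \<open>[0,1)\<close> lies in exactly one
  cell \<open>[a j, a (j+1))\<close>, so the description below is well defined.\<close>

definition cell_index :: "nat \<Rightarrow> (nat \<Rightarrow> real) \<Rightarrow> real \<Rightarrow> nat" where
  "cell_index m a x = (THE j. j < m \<and> a j \<le> x \<and> x < a (Suc j))"

definition g_dagger ::
  "nat \<Rightarrow> (nat \<Rightarrow> real) \<Rightarrow> (nat \<Rightarrow> real \<Rightarrow> real) \<Rightarrow> real \<Rightarrow> real" where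
  "g_dagger m a h x =
     (if 0 \<le> x \<and> x < 1
      then let j = cell_index m a x in h j ((x - a j) / (a (Suc j) - a j))
      else 0)"

text \<open>Significant decimal digits \<open>d 1, ..., d n\<close>; indices outside \<open>{1..n}\<close> are irrelevant.\<close>

definition leading_digits :: "nat \<Rightarrow> (nat \<Rightarrow> nat) \<Rightarrow> bool" where
  "leading_digits n d \<longleftrightarrow> d 1 \<in> {1..9} \<and> (\<forall>i\<in>{2..n}. d i \<in> {0..9})"

definition digits_lower :: "nat \<Rightarrow> (nat \<Rightarrow> nat) \<Rightarrow> real" where
  "digits_lower n d = (\<Sum>i=1..n. real (d i) / 10 ^ (i - 1))"

definition digits_upper :: "nat \<Rightarrow> (nat \<Rightarrow> nat) \<Rightarrow> real" where
  "digits_upper n d = (\<Sum>i=1..<n. real (d i) / 10 ^ (i - 1)) + (real (d n) + 1) / 10 ^ (n - 1)"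

definition digits_value :: "nat \<Rightarrow> (nat \<Rightarrow> nat) \<Rightarrow> real" where
  "digits_value n d = (\<Sum>i=1..n. 10 ^ (n - i) * real (d i))"

end

theory Submission
  imports Defs
begin

text \<open>On a cell \<open>[a j, a (j+1))\<close> the function \<open>g_dagger\<close> is a density on \<open>[0,1]\<close> transported by
  the increasing affine bijection from the cell to the unit interval, without the factor that would
  preserve mass.  The substitution rule therefore multiplies the mass 1 by the length of the cell,
  and adding neighbouring cells gives \<open>a l - a k\<close> over any block of cells, whatever the densities.

  For the digit statement it then suffices to choose a partition that contains every digit
  endpoint.  With \<open>M = 10^(n-1)\<close>, the strings of \<open>n\<close> significant digits correspond to the integers
  \<open>v\<close> with \<open>M \<le> v < 10 M\<close>, and their endpoints are \<open>log 10 (v / M)\<close> and \<open>log 10 ((v + 1) / M)\<close>.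
  These endpoints cut \<open>[0,1)\<close> into only \<open>9 M\<close> intervals while \<open>10 M\<close> cells are required, so
  the last interval is split into \<open>M + 1\<close> pieces.  Each digit interval is then a block of cells
  (a single one except for the digit string consisting of nines), and its length is
  \<open>log 10 ((v + 1) / v)\<close>.

  Integrals over cells are handled in the Henstock--Kurzweil sense, where affine substitution and
  gluing of adjacent intervals are convenient; since \<open>g_dagger\<close> is nonnegative, this agrees with
  the Lebesgue integral.\<close>

section \<open>The integral over a block of cells\<close>

lemma unit_partition_strict_mono:
  assumes "unit_partition m a" "i < j" "j \<le> m"
  shows "a i < a j"
proof (rule lift_Suc_mono_less_ivl)
  show "{i..<j} \<subseteq> {..<m}" using assms(3) by auto
qed (use assms in \<open>auto simp: unit_partition_def\<close>)

lemma unit_partition_mono: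
  assumes "unit_partition m a" "i \<le> j" "j \<le> m"
  shows "a i \<le> a j"
  using unit_partition_strict_mono[OF assms(1), of i j] assms(2,3)
  by (cases "i = j") auto

lemma unit_partition_bounds:
  assumes "unit_partition m a" "j \<le> m"
  shows "0 \<le> a j" "a j \<le> 1"
  using unit_partition_mono[OF assms(1), of 0 j] unit_partition_mono[OF assms(1), of j m] assms
  by (auto simp: unit_partition_def)

lemma cell_index_eqI:
  assumes a: "unit_partition m a" and j: "j < m" "a j \<le> x" "x < a (Suc j)"
  shows "cell_index m a x = j"
  unfolding cell_index_def
proof (rule the_equality)
  fix i assume i: "i < m \<and> a i \<le> x \<and> x < a (Suc i)"
  have "\<not> i < j"
    using unit_partition_mono[OF a, of "Suc i" j] i j by auto
  moreover have "\<not> j < i"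
    using unit_partition_mono[OF a, of "Suc j" i] i j by auto
  ultimately show "i = j" by simp
qed (use j in auto)

lemma unit_partition_cell_exists:
  assumes a: "unit_partition m a" and x: "0 \<le> x" "x < 1"
  obtains j where "j < m" "a j \<le> x" "x < a (Suc j)"
proof -
  define i where "i = (LEAST i. x < a i)"
  have "x < a m" using a x by (simp add: unit_partition_def)
  then have i: "x < a i" "i \<le> m"
    unfolding i_def by (auto intro: LeastI Least_le)
  have "i \<noteq> 0" using i a x by (auto simp: unit_partition_def intro: ccontr)
  then obtain j where j: "i = Suc j" by (cases i) auto
  then have "\<not> x < a j" unfolding i_def using not_less_Least[of j "\<lambda>i. x < a i"] by simp
  then show ?thesis using that[of j] i j by auto
qed

lemma g_dagger_on_cell:
  assumes "unit_partition m a" "j < m" "a j \<le> x" "x < a (Suc j)"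
  shows "g_dagger m a h x = h j ((x - a j) / (a (Suc j) - a j))"
  using cell_index_eqI[OF assms] unit_partition_bounds[OF assms(1), of j]
    unit_partition_bounds[OF assms(1), of "Suc j"] assms
  by (simp add: g_dagger_def)

lemma g_dagger_nonneg:
  assumes a: "unit_partition m a" and h: "\<forall>j<m. unit_density (h j)"
  shows "0 \<le> g_dagger m a h x"
proof (cases "0 \<le> x \<and> x < 1")
  case True
  then obtain j where j: "j < m" "a j \<le> x" "x < a (Suc j)"
    using unit_partition_cell_exists[OF a] by blast
  have "(x - a j) / (a (Suc j) - a j) \<in> {0..1}"
    using j by (auto simp: divide_simps)
  then show ?thesis
    using g_dagger_on_cell[OF a j] h j by (simp add: unit_density_def)
qed (auto simp: g_dagger_def)

text \<open>The right endpoint belongs to the next cell, so the substitution is compared with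
  \<open>g_dagger\<close> on the open cell only; the endpoints do not affect the integral.\<close>

lemma g_dagger_has_integral_cell:
  assumes a: "unit_partition m a" and h: "unit_density (h j)" and j: "j < m"
  shows "(g_dagger m a h has_integral (a (Suc j) - a j)) {a j..a (Suc j)}"
proof -
  define L where "L = a (Suc j) - a j"
  have L: "L > 0" using a j by (simp add: L_def unit_partition_def)
  have "(h j has_integral 1) (cbox 0 1)"
    using h has_integral_set_lebesgue[of "{0..1}" "h j"] by (simp add: unit_density_def)
  then have "((\<lambda>x. h j ((1 / L) *\<^sub>R x + - (a j / L))) has_integral 1 /\<^sub>R (1 / L) ^ DIM(real))
      (cbox ((0 - - (a j / L)) /\<^sub>R (1 / L)) ((1 - - (a j / L)) /\<^sub>R (1 / L)))"
    by (rule has_integral_affinity') (use L in simp)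
  moreover have "(1 / L) *\<^sub>R x + - (a j / L) = (x - a j) / L" for x
    by (simp add: diff_divide_distrib)
  moreover have "1 /\<^sub>R (1 / L) ^ DIM(real) = L" "(0 - - (a j / L)) /\<^sub>R (1 / L) = a j"
    using L by simp_all
  moreover have "(1 - - (a j / L)) /\<^sub>R (1 / L) = a j + L"
    using L by (simp add: distrib_left)
  ultimately have "((\<lambda>x. h j ((x - a j) / L)) has_integral L) {a j..a j + L}"
    by (simp only: cbox_interval)
  then have "((\<lambda>x. h j ((x - a j) / L)) has_integral L) {a j<..<a (Suc j)}"
    by (simp add: has_integral_Icc_iff_Ioo L_def)
  then have "(g_dagger m a h has_integral L) {a j<..<a (Suc j)}"
    by (rule has_integral_eq[rotated]) (use g_dagger_on_cell[OF a j] in \<open>auto simp: L_def\<close>)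
  then show ?thesis by (simp add: has_integral_Icc_iff_Ioo L_def)
qed

lemma g_dagger_has_integral_block:
  assumes a: "unit_partition m a" and h: "\<forall>j<m. unit_density (h j)"
    and "k \<le> l" "l \<le> m"
  shows "(g_dagger m a h has_integral (a l - a k)) {a k..a l}"
  using \<open>k \<le> l\<close> \<open>l \<le> m\<close>
proof (induction l rule: dec_induct)
  case base
  show ?case using has_integral_refl(2)[of "g_dagger m a h" "a k"] by simp
next
  case (step l)
  have "(g_dagger m a h has_integral (a l - a k) + (a (Suc l) - a l)) {a k..a (Suc l)}"
  proof (rule has_integral_combine)
    show "a k \<le> a l" "a l \<le> a (Suc l)"
      using unit_partition_mono[OF a] step by auto
    show "(g_dagger m a h has_integral (a l - a k)) {a k..a l}"
      using step by simp
    show "(g_dagger m a h has_integral (a (Suc l) - a l)) {a l..a (Suc l)}"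
      using g_dagger_has_integral_cell[OF a] h step by simp
  qed
  then show ?case by simp
qed

text \<open>Nonnegativity is what turns a Henstock--Kurzweil integral into a Lebesgue integral.\<close>

lemma interval_lebesgue_integral_nonneg_eq:
  fixes f :: "real \<Rightarrow> real"
  assumes "p \<le> q" "(f has_integral I) {p..q}" "\<And>x. 0 \<le> f x"
  shows "(LINT x=ereal p..ereal q|lebesgue. f x) = I"
proof -
  have I: "(f has_integral I) {p<..<q}"
    using assms(2) by (simp add: has_integral_Icc_iff_Ioo)
  then have "f absolutely_integrable_on {p<..<q}"
    using assms(3) by (intro nonnegative_absolutely_integrable_1) auto
  then have "(LINT x:{p<..<q}|lebesgue. f x) = I"
    using I by (simp add: set_lebesgue_integral_eq_integral integral_unique)
  then show ?thesis
    using assms(1) by (simp add: interval_lebesgue_integral_def)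
qed

lemma g_dagger_integral_block:
  assumes "unit_partition m a" "\<forall>j<m. unit_density (h j)" "k \<le> l" "l \<le> m"
  shows "(LINT x=ereal (a k)..ereal (a l)|lebesgue. g_dagger m a h x) = a l - a k"
proof (rule interval_lebesgue_integral_nonneg_eq)
  show "a k \<le> a l"
    using unit_partition_mono[OF assms(1,3,4)] .
  show "(g_dagger m a h has_integral (a l - a k)) {a k..a l}"
    using g_dagger_has_integral_block[OF assms] .
  show "0 \<le> g_dagger m a h x" for x
    using g_dagger_nonneg[OF assms(1,2)] .
qed

lemma unit_density_const_1: "unit_density (\<lambda>x. 1)"
proof -
  have *: "((\<lambda>x::real. 1::real) has_integral 1) {0..1}"
    using has_integral_const_real[of "1::real" 0 1] by simp
  then have "(\<lambda>x::real. 1::real) absolutely_integrable_on {0..1}"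
    by (intro nonnegative_absolutely_integrable_1) auto
  then show ?thesis
    using * by (simp add: unit_density_def set_lebesgue_integral_eq_integral)
qed

section \<open>Intervals with prescribed leading digits\<close>

lemma digits_value_bounds:
  assumes "n \<ge> 1" "leading_digits n d"
  shows "\<exists>v. digits_value n d = real v \<and> 10 ^ (n - 1) \<le> v \<and> v < 10 ^ n"
  using assms
proof (induction n rule: nat_induct_at_least)
  case base
  then show ?case by (auto simp: leading_digits_def digits_value_def)
next
  case (Suc n)
  then obtain v where v: "digits_value n d = real v" "10 ^ (n - 1) \<le> v" "v < 10 ^ n"
    by (auto simp: leading_digits_def)
  have "digits_value (Suc n) d = 10 * digits_value n d + real (d (Suc n))"
    by (simp add: digits_value_def sum_distrib_left Suc_diff_le mult.assoc)
  then have "digits_value (Suc n) d = real (10 * v + d (Suc n))"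
    using v by simp
  moreover have "d (Suc n) \<le> 9"
    using Suc by (simp add: leading_digits_def)
  then have "10 * v + d (Suc n) < 10 ^ Suc n"
    using v by simp
  moreover have "10 ^ (Suc n - 1) \<le> 10 * v + d (Suc n)"
    using v Suc.hyps by (cases n) auto
  ultimately show ?case by blast
qed

lemma digits_lower_eq: "digits_lower n d = digits_value n d / 10 ^ (n - 1)"
  unfolding digits_lower_def digits_value_def sum_divide_distrib
proof (rule sum.cong)
  fix i assume "i \<in> {1..n}"
  then have "n - 1 = (n - i) + (i - 1)" by simp
  then have "(10::real) ^ (n - 1) = 10 ^ (n - i) * 10 ^ (i - 1)"
    by (metis power_add)
  then show "real (d i) / 10 ^ (i - 1) = 10 ^ (n - i) * real (d i) / 10 ^ (n - 1)"
    by simp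
qed simp

lemma digits_upper_eq:
  assumes "n \<ge> 1"
  shows "digits_upper n d = (digits_value n d + 1) / 10 ^ (n - 1)"
proof -
  have "{1..n} = insert n {1..<n}" using assms by auto
  then have "digits_upper n d = digits_lower n d + 1 / 10 ^ (n - 1)"
    by (simp add: digits_upper_def digits_lower_def add_divide_distrib)
  then show ?thesis by (simp add: digits_lower_eq add_divide_distrib)
qed

text \<open>The integers \<open>0, ..., 9 M - 1\<close>, followed by \<open>M + 1\<close> equal steps from \<open>9 M - 1\<close> to \<open>9 M\<close>.\<close>

definition refined_node :: "nat \<Rightarrow> nat \<Rightarrow> real" where
  "refined_node M j =
     (if j < 9 * M then real j
      else real (9 * M) - 1 + (real j - (real (9 * M) - 1)) / (real M + 1))"

definition digit_partition :: "nat \<Rightarrow> nat \<Rightarrow> real" where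
  "digit_partition M j = log 10 (1 + refined_node M j / real M)"

lemma refined_node_nonneg: "M \<ge> 1 \<Longrightarrow> 0 \<le> refined_node M j"
  by (auto simp: refined_node_def intro!: add_nonneg_nonneg divide_nonneg_nonneg)

lemma refined_node_less_Suc:
  assumes "M \<ge> 1"
  shows "refined_node M j < refined_node M (Suc j)"
proof -
  consider "Suc j < 9 * M" | "Suc j = 9 * M" | "9 * M \<le> j" by linarith
  then show ?thesis
  proof cases
    case 2
    then have "real j = 9 * real M - 1" by linarith
    moreover have "(0::real) < 1 / (real M + 1)" by simp
    ultimately have "real j < 9 * real M - 1 + 1 / (real M + 1)" by linarith
    then show ?thesis using 2 by (simp add: refined_node_def)
  qed (auto simp: refined_node_def divide_strict_right_mono)
qed

lemma refined_node_last:
  assumes "M \<ge> 1"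
  shows "refined_node M (10 * M) = real (9 * M)"
  using assms by (simp add: refined_node_def)

lemma unit_partition_digit_partition:
  assumes M: "M \<ge> 1"
  shows "unit_partition (10 * M) (digit_partition M)"
  unfolding unit_partition_def
proof (intro conjI allI impI)
  show "digit_partition M 0 = 0"
    using M by (simp add: digit_partition_def refined_node_def)
  show "digit_partition M (10 * M) = 1"
    using M by (simp add: digit_partition_def refined_node_last)
  fix j
  have "refined_node M j / real M < refined_node M (Suc j) / real M"
    using refined_node_less_Suc[OF M] M by (intro divide_strict_right_mono) auto
  moreover have "0 \<le> refined_node M j / real M"
    using refined_node_nonneg[OF M] by simp
  ultimately show "digit_partition M j < digit_partition M (Suc j)"
    by (simp add: digit_partition_def)
qed

lemma digit_partition_at_significand:
  assumes "M \<le> v" "v < 10 * M"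
  shows "digit_partition M (v - M) = log 10 (real v / real M)"
  using assms
  by (simp add: digit_partition_def refined_node_def less_diff_conv2 diff_divide_distrib)

text \<open>The right endpoint of the last digit interval is the node of index \<open>10 M\<close>, not \<open>9 M\<close>, because
  of the additional nodes.\<close>

lemma digit_interval_is_block:
  assumes "M \<le> v" "v < 10 * M"
  obtains k l where "k < l" "l \<le> 10 * M"
    "digit_partition M k = log 10 (real v / real M)"
    "digit_partition M l = log 10 ((real v + 1) / real M)"
proof (cases "Suc v < 10 * M")
  case True
  show ?thesis
    by (rule that[of "v - M" "Suc v - M"])
      (use assms True digit_partition_at_significand[of M v]
         digit_partition_at_significand[of M "Suc v"] in \<open>auto simp: add.commute\<close>)
next
  case False
  have M: "M \<ge> 1" using assms by simp
  have "real v + 1 = 10 * real M" using False assms by linarith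
  moreover have "digit_partition M (10 * M) = 1"
    using unit_partition_digit_partition[OF M] by (simp add: unit_partition_def)
  ultimately show ?thesis
    by (intro that[of "v - M" "10 * M"])
      (use assms M digit_partition_at_significand[OF assms] in auto)
qed

lemma digit_partition_integral:
  assumes n: "n \<ge> 1" and h: "\<forall>j<10 ^ n. unit_density (h j)" and d: "leading_digits n d"
  shows "(LINT x=ereal (log 10 (digits_lower n d))..ereal (log 10 (digits_upper n d))|lebesgue.
            g_dagger (10 ^ n) (digit_partition (10 ^ (n - 1))) h x)
         = log 10 (1 + 1 / digits_value n d)"
proof -
  define M :: nat where "M = 10 ^ (n - 1)"
  have M: "M \<ge> 1" "10 ^ n = 10 * M" "10 ^ (n - 1) = real M"
    using n by (cases n; simp add: M_def)+
  obtain v where v: "digits_value n d = real v" "M \<le> v" "v < 10 * M"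
    using digits_value_bounds[OF n d] M M_def by auto
  obtain k l where kl: "k < l" "l \<le> 10 * M"
    "digit_partition M k = log 10 (digits_lower n d)"
    "digit_partition M l = log 10 (digits_upper n d)"
    using digit_interval_is_block[OF v(2,3)] digits_lower_eq[of n d] digits_upper_eq[OF n, of d] v M
    by metis
  have "(LINT x=ereal (digit_partition M k)..ereal (digit_partition M l)|lebesgue.
           g_dagger (10 ^ n) (digit_partition M) h x) = digit_partition M l - digit_partition M k"
    unfolding M(2)
    by (rule g_dagger_integral_block[OF unit_partition_digit_partition[OF M(1)]])
      (use h kl M(2) in auto)
  also have "\<dots> = log 10 ((real v + 1) / real M) - log 10 (real v / real M)"
    by (simp only: kl digits_lower_eq digits_upper_eq[OF n] v(1) M(3))
  also have "\<dots> = log 10 (((real v + 1) / real M) / (real v / real M))"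
    using v M by (subst log_divide) auto
  also have "((real v + 1) / real M) / (real v / real M) = 1 + 1 / real v"
    using v M by (simp add: field_simps)
  finally show ?thesis
    using kl v by (simp add: M_def)
qed

theorem mainTheorem2:
  fixes n :: nat
  assumes "n \<ge> 1"
  shows
    "(\<forall>(a :: nat \<Rightarrow> real) (h :: nat \<Rightarrow> real \<Rightarrow> real). unit_partition (10 ^ n) a \<and> (\<forall>j<10 ^ n. unit_density (h j)) \<longrightarrow>
        (\<forall>j<10 ^ n.
           (LINT x=ereal (a j)..ereal (a (Suc j))|lebesgue. g_dagger (10 ^ n) a h x)
             = a (Suc j) - a j) \<and>
        (\<forall>k l. k < l \<and> l \<le> 10 ^ n \<longrightarrow>
           (LINT x=ereal (a k)..ereal (a l)|lebesgue. g_dagger (10 ^ n) a h x)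
             = a l - a k)) \<and>
     (\<exists>a. unit_partition (10 ^ n) a \<and>
        (\<exists>h :: nat \<Rightarrow> real \<Rightarrow> real. \<forall>j<10 ^ n. unit_density (h j)) \<and>
        (\<forall>h. (\<forall>j<10 ^ n. unit_density (h j)) \<longrightarrow>
           (\<forall>d. leading_digits n d \<longrightarrow>
              (LINT x=ereal (log 10 (digits_lower n d))..ereal (log 10 (digits_upper n d))|lebesgue.
                 g_dagger (10 ^ n) a h x)
                = log 10 (1 + 1 / digits_value n d))))"
proof (intro conjI allI impI, goal_cases)
  case (1 a h j)
  then show ?case by (intro g_dagger_integral_block) auto
next
  case (2 a h k l)
  then show ?case by (intro g_dagger_integral_block) auto
next
  case 3
  have "(10::nat) ^ n = 10 * 10 ^ (n - 1)"
    using assms by (cases n) simp_all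
  then have "unit_partition (10 ^ n) (digit_partition (10 ^ (n - 1)))"
    using unit_partition_digit_partition[of "10 ^ (n - 1)"] by simp
  moreover have "\<exists>h :: nat \<Rightarrow> real \<Rightarrow> real. \<forall>j<10 ^ n. unit_density (h j)"
    using unit_density_const_1 by (intro exI[of _ "\<lambda>_ _. 1"]) simp
  ultimately show ?case
    using digit_partition_integral[OF assms] by blast
qed

end
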